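(* Let $(X_t)_{t\in\mathbb R_+}$ be a Brownian motion on a probability space $(\Omega,\mathcal F,P)$. Then for every $\beta\in(0,\tfrac12)$, almost surely the path $t\mapsto X_t(\omega)$ is locally $\beta$-Hölder continuous on $\mathbb R_+$.
   Context: A real-valued stochastic process $(X_t)_{t\in\mathbb R_+}$ is a Brownian motion if it has continuous paths almost surely and, for all $n\in\mathbb N$ and $t_1,\dots,t_n\in\mathbb R_+=[0,\infty)$, the vector $(X_{t_1},\dots,X_{t_n})$ has a (possibly degenerate) multivariate normal distribution with mean $0$ and covariance matrix $\mathbf{cov}(X_{t_i},X_{t_j})=\min(t_i,t_j)$. A function $f:\mathbb R_+\to\mathbb R$ is locally $\beta$-Hölder continuous if every $t\in\mathbb R_+$ has a neighborhood $U$ in $\mathbb R_+$ for which there is a finite constant $C$ with $|f(r)-f(s)|\le C|r-s|^\beta$ for all $r,s\in U$. *)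

theory Defs
  imports "HOL-Probability.Probability"
begin

context prob_space
begin

definition covariance :: "('a \<Rightarrow> real) \<Rightarrow> ('a \<Rightarrow> real) \<Rightarrow> real" where
  "covariance Y Z = expectation (\<lambda>\<omega>. (Y \<omega> - expectation Y) * (Z \<omega> - expectation Z))"

text \<open>The second disjunct is the degenerate normal distribution (variance zero).\<close>

definition normal_rv :: "('a \<Rightarrow> real) \<Rightarrow> bool" where
  "normal_rv Y \<longleftrightarrow>
     (\<exists>m \<sigma>. \<sigma> > 0 \<and> distributed M lborel Y (normal_density m \<sigma>)) \<or>
     (\<exists>m. random_variable borel Y \<and> distr M borel Y = return borel m)"

text \<open>
  A random vector, indexed by the (finite) set \<open>I\<close>, is multivariate normal, possibly degenerate,
  iff all linear combinations of its components are (possibly degenerate) normal.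
  The last two conjuncts fix the mean vector \<open>\<mu>\<close> and the covariance matrix \<open>\<Sigma>\<close>.
  All components are square integrable because they are themselves normal, so the
  expectations involved are genuine.
\<close>

definition multivariate_normal ::
  "'i set \<Rightarrow> ('i \<Rightarrow> 'a \<Rightarrow> real) \<Rightarrow> ('i \<Rightarrow> real) \<Rightarrow> ('i \<Rightarrow> 'i \<Rightarrow> real) \<Rightarrow> bool" where
  "multivariate_normal I Y \<mu> \<Sigma> \<longleftrightarrow>
     finite I \<and>
     (\<forall>i\<in>I. random_variable borel (Y i)) \<and>
     (\<forall>a :: 'i \<Rightarrow> real. normal_rv (\<lambda>\<omega>. \<Sum>i\<in>I. a i * Y i \<omega>)) \<and>
     (\<forall>i\<in>I. expectation (Y i) = \<mu> i) \<and>
     (\<forall>i\<in>I. \<forall>j\<in>I. covariance (Y i) (Y j) = \<Sigma> i j)"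

text \<open>The process is indexed by all reals, but only its values at times \<open>t \<ge> 0\<close> are constrained.\<close>

definition brownian_motion :: "(real \<Rightarrow> 'a \<Rightarrow> real) \<Rightarrow> bool" where
  "brownian_motion X \<longleftrightarrow>
     (\<forall>t\<ge>0. random_variable borel (X t)) \<and>
     (AE \<omega> in M. continuous_on {0..} (\<lambda>t. X t \<omega>)) \<and>
     (\<forall>(n :: nat) (t :: nat \<Rightarrow> real). (\<forall>i<n. t i \<ge> 0) \<longrightarrow>
        multivariate_normal {..<n} (\<lambda>i. X (t i)) (\<lambda>_. 0) (\<lambda>i j. min (t i) (t j)))"

end

definition locally_holder :: "real \<Rightarrow> (real \<Rightarrow> real) \<Rightarrow> bool" where
  "locally_holder \<beta> f \<longleftrightarrow>
     (\<forall>t\<ge>0. \<exists>U V. openin (top_of_set {0..}) V \<and> t \<in> V \<and> V \<subseteq> U \<and> U \<subseteq> {0..} \<and>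
        (\<exists>C. \<forall>r\<in>U. \<forall>s\<in>U. \<bar>f r - f s\<bar> \<le> C * \<bar>r - s\<bar> powr \<beta>))"

end

theory Submission
  imports Defs
begin

text \<open>
  An increment of \<open>X\<close> over a time step of length \<open>h\<close> is centred normal with variance \<open>h\<close>, so
  its moment of order \<open>2k\<close> is a multiple of \<open>h\<^sup>k\<close>.  By Markov's inequality, the probability that
  some increment over a dyadic interval of length \<open>2\<^sup>-\<^sup>n\<close> in \<open>[0, N]\<close> exceeds \<open>2\<^sup>-\<^sup>\<beta>\<^sup>n\<close> is at most
  a multiple of \<open>\<rho>\<^sup>n\<close> with \<open>\<rho> = 2 powr (1 - k + 2k\<beta>)\<close>, and \<open>\<rho> < 1\<close> for large \<open>k\<close>.  By Borel--Cantelli,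
  almost surely all fine dyadic increments are small.  Continuity and chaining along the
  dyadic approximations of two points then give the Hoelder estimate.
\<close>

subsection \<open>From dyadic increments to a modulus of continuity\<close>

text \<open>The cast through \<open>nat\<close> makes every value literally a grid point
  \<open>real j / 2 ^ n\<close>, matching the increment hypotheses below. A negative
  \<open>r\<close> is sent to 0.\<close>

definition dyadic_floor :: "nat \<Rightarrow> real \<Rightarrow> real" where
  "dyadic_floor n r = real (nat \<lfloor>r * 2 ^ n\<rfloor>) / 2 ^ n"

lemma dyadic_floor_nonneg: "0 \<le> dyadic_floor n r"
  by (simp add: dyadic_floor_def)

lemma dyadic_floor_tendsto:
  assumes "0 \<le> r"
  shows "(\<lambda>n. dyadic_floor n r) \<longlonglongrightarrow> r"
proof (rule tendsto_sandwich)
  have fl: "r * 2 ^ n - 1 \<le> real (nat \<lfloor>r * 2 ^ n\<rfloor>)" "real (nat \<lfloor>r * 2 ^ n\<rfloor>) \<le> r * 2 ^ n" for n :: nat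
    using assms by (auto simp: of_nat_nat)
  have "r - (1 / 2) ^ n \<le> dyadic_floor n r" for n
  proof -
    have "(r * 2 ^ n - 1) / 2 ^ n \<le> dyadic_floor n r"
      unfolding dyadic_floor_def using fl(1) by (rule divide_right_mono) simp
    then show ?thesis
      by (simp add: diff_divide_distrib power_divide)
  qed
  then show "\<forall>\<^sub>F n in sequentially. r - (1 / 2) ^ n \<le> dyadic_floor n r"
    by simp
  show "\<forall>\<^sub>F n in sequentially. dyadic_floor n r \<le> r"
    using fl(2) by (intro always_eventually) (auto simp: dyadic_floor_def field_simps)
  have "(\<lambda>n. r - (1 / 2) ^ n) \<longlonglongrightarrow> r - 0"
    by (intro tendsto_intros LIMSEQ_realpow_zero) auto
  then show "(\<lambda>n. r - (1 / 2) ^ n) \<longlonglongrightarrow> r"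
    by simp
qed simp

text \<open>This is the refinement step of the chaining: at the next dyadic level the approximating
  point stays where it is or moves one fine step to the right.\<close>

lemma nat_floor_double:
  fixes x :: real
  assumes "0 \<le> x"
  shows "nat \<lfloor>2 * x\<rfloor> = 2 * nat \<lfloor>x\<rfloor> \<or> nat \<lfloor>2 * x\<rfloor> = 2 * nat \<lfloor>x\<rfloor> + 1"
proof -
  have "\<lfloor>2 * x\<rfloor> = 2 * \<lfloor>x\<rfloor> \<or> \<lfloor>2 * x\<rfloor> = 2 * \<lfloor>x\<rfloor> + 1"
    by linarith
  moreover have "0 \<le> \<lfloor>x\<rfloor>" using assms by simp
  ultimately show ?thesis by linarith
qed

lemma nat_floor_less:
  fixes r :: real
  assumes "0 \<le> r" "r < real N"
  shows "nat \<lfloor>r * 2 ^ n\<rfloor> < N * 2 ^ n"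
proof -
  have "r * 2 ^ n < real (N * 2 ^ n)"
    using assms by simp
  moreover have "0 \<le> r * 2 ^ n"
    using assms by simp
  ultimately show ?thesis
    by linarith
qed

text \<open>Consecutive dyadic approximations of \<open>r\<close> differ by at most one grid
  increment, so the error telescopes into a geometric series from level \<open>n\<close> on.
  Continuity identifies the limit as \<open>f r\<close>.\<close>

lemma chaining_bound:
  fixes f :: "real \<Rightarrow> real" and q :: real
  assumes cont: "continuous_on {0..} f" and q: "0 < q" "q < 1"
    and inc: "\<And>n j. n0 \<le> n \<Longrightarrow> j < N * 2 ^ n \<Longrightarrow>
      \<bar>f (real (j + 1) / 2 ^ n) - f (real j / 2 ^ n)\<bar> \<le> q ^ n"
    and r: "0 \<le> r" "r < real N" and n: "n0 \<le> n"
  shows "\<bar>f r - f (dyadic_floor n r)\<bar> \<le> q ^ n / (1 - q)"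
proof -
  have step: "\<bar>f (dyadic_floor (Suc m) r) - f (dyadic_floor m r)\<bar> \<le> q ^ m" if "n0 \<le> m" for m
  proof -
    define a where "a = nat \<lfloor>r * 2 ^ m\<rfloor>"
    \<comment> \<open>The coarse point is rewritten on the finer grid, so that both points have the
      same denominator and equal or adjacent indices.\<close>
    have eq: "dyadic_floor m r = real (2 * a) / 2 ^ Suc m"
      by (simp add: dyadic_floor_def a_def)
    have "nat \<lfloor>r * 2 ^ Suc m\<rfloor> = 2 * a \<or> nat \<lfloor>r * 2 ^ Suc m\<rfloor> = 2 * a + 1"
      using nat_floor_double[of "r * 2 ^ m"] r by (simp add: a_def mult_ac)
    then have "dyadic_floor (Suc m) r = real (2 * a) / 2 ^ Suc m \<or>
        dyadic_floor (Suc m) r = real (2 * a + 1) / 2 ^ Suc m"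
      unfolding dyadic_floor_def by metis
    moreover have "2 * a < N * 2 ^ Suc m"
      using nat_floor_less[OF r, of m] by (simp add: a_def)
    then have "\<bar>f (real (2 * a + 1) / 2 ^ Suc m) - f (real (2 * a) / 2 ^ Suc m)\<bar> \<le> q ^ Suc m"
      using that by (intro inc) auto
    \<comment> \<open>Relaxing to \<open>q ^ m\<close> lets the series sum to
      \<open>q ^ n / (1 - q)\<close>; nonnegativity covers the case of coinciding points.\<close>
    moreover have "q ^ Suc m \<le> q ^ m" "0 \<le> q ^ m"
      using q by (auto simp: mult_le_cancel_right1)
    ultimately show ?thesis
      unfolding eq by auto
  qed
  \<comment> \<open>The exact partial sum is kept because the bound \<open>q ^ n / (1 - q)\<close>
    alone would not survive the induction.\<close>
  have part: "\<bar>f (dyadic_floor (n + m) r) - f (dyadic_floor n r)\<bar> \<le> (q ^ n - q ^ (n + m)) / (1 - q)" for m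
  proof (induction m)
    case (Suc m)
    have "(q ^ n - q ^ (n + m)) / (1 - q) + q ^ (n + m) = (q ^ n - q ^ (n + Suc m)) / (1 - q)"
      using q by (simp add: field_simps)
    then show ?case
      using Suc step[of "n + m"] n by simp
  qed simp
  have "(\<lambda>m. dyadic_floor (n + m) r) \<longlonglongrightarrow> r"
    using LIMSEQ_ignore_initial_segment[OF dyadic_floor_tendsto[OF r(1)], of n]
    by (simp add: add.commute)
  then have "(\<lambda>m. f (dyadic_floor (n + m) r)) \<longlonglongrightarrow> f r"
    using r by (intro continuous_on_tendsto_compose[OF cont]) (auto simp: dyadic_floor_nonneg)
  then have "(\<lambda>m. \<bar>f (dyadic_floor (n + m) r) - f (dyadic_floor n r)\<bar>)
      \<longlonglongrightarrow> \<bar>f r - f (dyadic_floor n r)\<bar>"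
    by (intro tendsto_intros)
  moreover have "\<bar>f (dyadic_floor (n + m) r) - f (dyadic_floor n r)\<bar> \<le> q ^ n / (1 - q)" for m
    by (rule order_trans[OF part]) (use q in \<open>auto intro!: divide_right_mono\<close>)
  ultimately show ?thesis
    by (intro LIMSEQ_le_const2[where X="\<lambda>m. \<bar>f (dyadic_floor (n + m) r) - f (dyadic_floor n r)\<bar>"]) auto
qed

text \<open>At this level two points at distance \<open>d\<close> lie in the same or adjacent cells,
  while the mesh is still below \<open>2 * d\<close>.\<close>

lemma dyadic_scale:
  fixes d :: real
  assumes "0 < d" "d \<le> (1 / 2) ^ n0"
  obtains n where "n0 \<le> n" "d \<le> (1 / 2) ^ n" "(1 / 2) ^ Suc n < d"
proof -
  obtain m where m: "(1 / 2) ^ m < d"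
    using real_arch_pow_inv[of d "1/2"] assms by auto
  define k where "k = (LEAST m. (1 / 2 :: real) ^ m < d)"
  have k: "(1 / 2) ^ k < d"
    unfolding k_def using m by (rule LeastI)
  \<comment> \<open>This gives \<open>n0 \<le> k - 1\<close> and also makes \<open>k\<close>
    positive, so that \<open>Suc (k - 1)\<close> is \<open>k\<close>.\<close>
  have nk: "n0 < k"
  proof (rule ccontr)
    assume "\<not> n0 < k"
    then have "(1 / 2 :: real) ^ n0 \<le> (1 / 2) ^ k"
      by (intro power_decreasing) auto
    with k assms show False by linarith
  qed
  have "\<not> (1 / 2 :: real) ^ (k - 1) < d"
    using nk unfolding k_def by (intro not_less_Least) auto
  with nk k show thesis
    by (intro that[of "k - 1"]) auto
qed

text \<open>At the dyadic level matching the distance of the two points, the path from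
  \<open>r\<close> to \<open>s\<close> splits into two chaining errors and at most one grid
  increment, each a multiple of \<open>q ^ n\<close>.\<close>

lemma dyadic_increments_imp_holder:
  fixes f :: "real \<Rightarrow> real" and \<beta> :: real
  assumes cont: "continuous_on {0..} f" and \<beta>: "0 < \<beta>"
    and inc: "\<And>n j. n0 \<le> n \<Longrightarrow> j < N * 2 ^ n \<Longrightarrow>
      \<bar>f (real (j + 1) / 2 ^ n) - f (real j / 2 ^ n)\<bar> \<le> (2 powr - \<beta>) ^ n"
  obtains C where "\<And>r s. r \<in> {0..<real N} \<Longrightarrow> s \<in> {0..<real N} \<Longrightarrow> \<bar>r - s\<bar> \<le> (1 / 2) ^ n0 \<Longrightarrow>
      \<bar>f r - f s\<bar> \<le> C * \<bar>r - s\<bar> powr \<beta>"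
proof -
  define q :: real where "q = 2 powr - \<beta>"
  have q: "0 < q" "q < 1"
    using \<beta> by (auto simp: q_def powr_less_one)
  have q_pow: "q ^ n = ((1 / 2) ^ n) powr \<beta>" for n
    by (simp add: q_def powr_powr powr_minus powr_divide powr_power inverse_eq_divide mult.commute
        flip: powr_realpow powr_mult)
  \<comment> \<open>The numerator collects the two chaining errors and the middle increment. The
    division by \<open>q\<close> pays for passing from \<open>q ^ n\<close> to
    \<open>q ^ Suc n\<close>, because it is \<open>(1 / 2) ^ Suc n\<close> that lies below the
    distance.\<close>
  define C where "C = (2 / (1 - q) + 1) / q"
  have lt: "\<bar>f r - f s\<bar> \<le> C * \<bar>r - s\<bar> powr \<beta>"
    if r: "0 \<le> r" and s: "s < real N" and rs: "r < s" "s - r \<le> (1 / 2) ^ n0" for r s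
  proof -
    obtain n where n: "n0 \<le> n" "s - r \<le> (1 / 2) ^ n" "(1 / 2) ^ Suc n < s - r"
      using dyadic_scale[of "s - r" n0] rs by auto
    define a where "a = nat \<lfloor>r * 2 ^ n\<rfloor>"
    \<comment> \<open>A distance of at most one mesh width forces the two floor indices to be equal
      or adjacent.\<close>
    have "(s - r) * 2 ^ n \<le> (1 / 2) ^ n * 2 ^ n"
      using n(2) by (intro mult_right_mono) auto
    then have "s * 2 ^ n \<le> r * 2 ^ n + 1"
      by (simp add: algebra_simps flip: power_mult_distrib)
    moreover have "r * 2 ^ n \<le> s * 2 ^ n" "0 \<le> r * 2 ^ n"
      using rs r by auto
    ultimately have "nat \<lfloor>s * 2 ^ n\<rfloor> = a \<or> nat \<lfloor>s * 2 ^ n\<rfloor> = a + 1"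
      unfolding a_def by linarith
    moreover have "\<bar>f (real (a + 1) / 2 ^ n) - f (real a / 2 ^ n)\<bar> \<le> q ^ n"
      unfolding q_def using n(1) nat_floor_less[of r N n] r s rs by (intro inc) (auto simp: a_def)
    moreover have "0 \<le> q ^ n"
      using q by simp
    ultimately have mid: "\<bar>f (dyadic_floor n s) - f (dyadic_floor n r)\<bar> \<le> q ^ n"
      unfolding dyadic_floor_def a_def[symmetric] by auto
    have "\<bar>f r - f (dyadic_floor n r)\<bar> \<le> q ^ n / (1 - q)"
      "\<bar>f s - f (dyadic_floor n s)\<bar> \<le> q ^ n / (1 - q)"
      using n(1) r s rs inc q by (auto simp: q_def intro!: chaining_bound[OF cont, of _ n0 N])
    with mid have "\<bar>f r - f s\<bar> \<le> 2 * (q ^ n / (1 - q)) + q ^ n"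
      by linarith
    also have "\<dots> = C * q ^ Suc n"
      using q by (simp add: C_def field_simps)
    also have "\<dots> \<le> C * (s - r) powr \<beta>"
    proof (rule mult_left_mono)
      show "q ^ Suc n \<le> (s - r) powr \<beta>"
        unfolding q_pow using n(3) \<beta> by (intro powr_mono2) auto
      show "0 \<le> C"
        using q by (simp add: C_def)
    qed
    finally show ?thesis
      using rs by simp
  qed
  show thesis
  proof (rule that[of C])
    fix r s assume *: "r \<in> {0..<real N}" "s \<in> {0..<real N}" "\<bar>r - s\<bar> \<le> (1 / 2) ^ n0"
    consider "r < s" | "r = s" | "s < r" by linarith
    then show "\<bar>f r - f s\<bar> \<le> C * \<bar>r - s\<bar> powr \<beta>"
      using lt[of r s] lt[of s r] * by cases (auto simp: abs_minus_commute)
  qed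
qed

lemma locally_holderI:
  assumes "\<And>N :: nat. \<exists>\<delta>>0. \<exists>C. \<forall>r\<in>{0..<real N}. \<forall>s\<in>{0..<real N}.
      \<bar>r - s\<bar> \<le> \<delta> \<longrightarrow> \<bar>f r - f s\<bar> \<le> C * \<bar>r - s\<bar> powr \<beta>"
  shows "locally_holder \<beta> f"
  unfolding locally_holder_def
proof (intro allI impI)
  fix t :: real assume t: "0 \<le> t"
  obtain N :: nat where N: "t < real N"
    using reals_Archimedean2 by blast
  obtain \<delta> C where \<delta>: "\<delta> > 0" and C: "\<And>r s. r \<in> {0..<real N} \<Longrightarrow> s \<in> {0..<real N} \<Longrightarrow>
      \<bar>r - s\<bar> \<le> \<delta> \<Longrightarrow> \<bar>f r - f s\<bar> \<le> C * \<bar>r - s\<bar> powr \<beta>"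
    using assms[of N] by blast
  \<comment> \<open>Half of \<open>\<delta>\<close> keeps any two points of the ball within
    \<open>\<delta>\<close> of each other; the second term keeps the ball below
    \<open>N\<close>.\<close>
  define e where "e = min (\<delta> / 2) (real N - t)"
  have e: "0 < e" using \<delta> N by (simp add: e_def)
  let ?U = "{0..} \<inter> ball t e"
  have "\<forall>r\<in>?U. \<forall>s\<in>?U. \<bar>f r - f s\<bar> \<le> C * \<bar>r - s\<bar> powr \<beta>"
  proof (intro ballI C)
    fix r s assume "r \<in> ?U" "s \<in> ?U"
    then show "r \<in> {0..<real N}" "s \<in> {0..<real N}" "\<bar>r - s\<bar> \<le> \<delta>"
      using abs_triangle_ineq4[of "t - s" "t - r"] by (auto simp: e_def dist_real_def)
  qed
  then show "\<exists>U V. openin (top_of_set {0..}) V \<and> t \<in> V \<and> V \<subseteq> U \<and> U \<subseteq> {0..} \<and>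
      (\<exists>C. \<forall>r\<in>U. \<forall>s\<in>U. \<bar>f r - f s\<bar> \<le> C * \<bar>r - s\<bar> powr \<beta>)"
    using t e by (intro exI[of _ ?U]) (auto intro!: openin_open_Int)
qed

subsection \<open>Moments of Gaussian increments\<close>

context prob_space
begin

lemma normal_rv_measurable: "normal_rv Y \<Longrightarrow> random_variable borel Y"
  unfolding normal_rv_def using distributed_measurable[of M lborel Y] by auto

text \<open>Integrability is what makes later moments genuine, since \<open>expectation\<close> of a
  non-integrable function is 0 by default.\<close>

lemma normal_rv_integrable_power:
  assumes "normal_rv Y"
  shows "integrable M (\<lambda>\<omega>. Y \<omega> ^ k)"
proof -
  have [measurable]: "random_variable borel Y"
    using assms by (rule normal_rv_measurable)
  from assms consider (nd) m \<sigma> where "\<sigma> > 0" "distributed M lborel Y (normal_density m \<sigma>)"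
    | (dg) m where "distr M borel Y = return borel m"
    unfolding normal_rv_def by blast
  then show ?thesis
  proof cases
    case nd
    \<comment> \<open>The available Gaussian moments are centred at \<open>m\<close>, so
      \<open>x ^ k\<close> is expanded binomially as a power of \<open>(x - m) + m\<close>.\<close>
    have "integrable lborel (\<lambda>x. normal_density m \<sigma> x * (\<Sum>i\<le>k. of_nat (k choose i) * (x - m) ^ i * m ^ (k - i)))"
      unfolding sum_distrib_left
    proof (intro Bochner_Integration.integrable_sum)
      fix i
      have "integrable lborel (\<lambda>x. normal_density m \<sigma> x * (x - m) ^ i * (of_nat (k choose i) * m ^ (k - i)))"
        using integrable_normal_moment[OF nd(1)] by (rule integrable_mult_left)
      then show "integrable lborel (\<lambda>x. normal_density m \<sigma> x * (of_nat (k choose i) * (x - m) ^ i * m ^ (k - i)))"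
        by (simp add: mult_ac)
    qed
    then have "integrable lborel (\<lambda>x. normal_density m \<sigma> x * x ^ k)"
      unfolding binomial_ring[symmetric] by simp
    then show ?thesis
      using distributed_integrable[OF nd(2), of "\<lambda>x. x ^ k"] by simp
  next
    case dg
    have "integrable (return borel m) (\<lambda>x. x ^ k)"
      by (intro integrableI_bounded) (auto simp: nn_integral_return)
    then show ?thesis
      unfolding dg[symmetric] by (subst (asm) integrable_distr_eq) auto
  qed
qed

text \<open>The first two moments force \<open>m = 0\<close> and variance \<open>v\<close>, which
  reduces the claim to the central moment formula of the normal density.\<close>

lemma normal_rv_moment_even:
  assumes "normal_rv Y" "expectation Y = 0" "expectation (\<lambda>\<omega>. (Y \<omega>)\<^sup>2) = v" "0 < v"
  shows "expectation (\<lambda>\<omega>. Y \<omega> ^ (2 * k)) = fact (2 * k) / (2 ^ k * fact k) * v ^ k"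
proof -
  have [measurable]: "random_variable borel Y"
    using assms by (intro normal_rv_measurable)
  from assms(1) consider (nd) m \<sigma> where "\<sigma> > 0" "distributed M lborel Y (normal_density m \<sigma>)"
    | (dg) m where "distr M borel Y = return borel m"
    unfolding normal_rv_def by blast
  then show ?thesis
  proof cases
    case nd
    have "m = 0"
      using normal_distributed_expectation[OF nd] assms by simp
    moreover have "\<sigma>\<^sup>2 = v"
      using normal_distributed_variance[OF nd] assms by simp
    ultimately show ?thesis
      using distributed_integral[OF nd(2), of "\<lambda>x. x ^ (2 * k)"] integral_normal_moment_even[OF nd(1), of m k]
      by (simp add: power_divide)
  next
    case dg
    \<comment> \<open>Under a point mass the first moment gives \<open>m = 0\<close> and the second
      gives \<open>m ^ 2 = v > 0\<close>, so this case is contradictory.\<close>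
    have "expectation (\<lambda>\<omega>. g (Y \<omega>)) = g m" if [measurable]: "g \<in> borel_measurable borel" for g :: "real \<Rightarrow> real"
      using integral_distr[of Y M borel g] by (simp add: dg integral_return)
    from this[of "\<lambda>x. x"] this[of "\<lambda>x. x\<^sup>2"] show ?thesis
      using assms by simp
  qed
qed

text \<open>Two-time marginals suffice for increments. The case \<open>s = t\<close> is allowed and
  yields the second moment of a single \<open>X t\<close>.\<close>

lemma brownian_motion_normal:
  assumes "brownian_motion X" "0 \<le> s" "0 \<le> t"
  shows "normal_rv (\<lambda>\<omega>. a * X s \<omega> + b * X t \<omega>)" "expectation (X t) = 0"
    "expectation (\<lambda>\<omega>. X s \<omega> * X t \<omega>) = min s t"
proof -
  have "multivariate_normal {..<2 :: nat} (\<lambda>i. X (if i = 0 then s else t)) (\<lambda>_. 0)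
      (\<lambda>i j. min (if i = 0 then s else t) (if j = 0 then s else t))"
    using assms unfolding brownian_motion_def by auto
  then have mv: "\<forall>c :: nat \<Rightarrow> real. normal_rv (\<lambda>\<omega>. \<Sum>i<2. c i * X (if i = 0 then s else t) \<omega>)"
    "\<forall>i<2. expectation (X (if i = (0::nat) then s else t)) = 0"
    "\<forall>i<2. \<forall>j<2. covariance (X (if i = (0::nat) then s else t)) (X (if j = (0::nat) then s else t)) =
      min (if i = 0 then s else t) (if j = 0 then s else t)"
    unfolding multivariate_normal_def by auto
  show "normal_rv (\<lambda>\<omega>. a * X s \<omega> + b * X t \<omega>)"
    using mv(1)[rule_format, of "\<lambda>i. if i = 0 then a else b"] by (simp add: numeral_2_eq_2)
  show *: "expectation (X t) = 0"
    using mv(2)[rule_format, of 1] by simp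
  have "expectation (X s) = 0"
    using mv(2)[rule_format, of 0] by simp
  with * show "expectation (\<lambda>\<omega>. X s \<omega> * X t \<omega>) = min s t"
    using mv(3)[rule_format, of 0 1] by (simp add: covariance_def)
qed

text \<open>The variance is \<open>t + s - 2 * min s t\<close>, that is \<open>t - s\<close>; the
  strict \<open>s < t\<close> makes it positive, as the moment formula requires.\<close>

lemma brownian_motion_increment:
  assumes X: "brownian_motion X" and st: "0 \<le> s" "s < t"
  shows "normal_rv (\<lambda>\<omega>. X t \<omega> - X s \<omega>)"
    and "expectation (\<lambda>\<omega>. (X t \<omega> - X s \<omega>) ^ (2 * k)) = fact (2 * k) / (2 ^ k * fact k) * (t - s) ^ k"
proof -
  have t: "0 \<le> t" using st by simp
  show nrv: "normal_rv (\<lambda>\<omega>. X t \<omega> - X s \<omega>)"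
    using brownian_motion_normal(1)[OF X st(1) t, of "-1" 1] by (simp add: add.commute)
  have nt: "normal_rv (X t)" and ns: "normal_rv (X s)"
    using brownian_motion_normal(1)[OF X st(1) t, of 0 1]
      brownian_motion_normal(1)[OF X st(1) t, of 1 0] by simp_all
  have "expectation (\<lambda>\<omega>. X t \<omega> - X s \<omega>) = 0"
    using normal_rv_integrable_power[OF nt, of 1] normal_rv_integrable_power[OF ns, of 1]
      brownian_motion_normal(2)[OF X st(1) t] brownian_motion_normal(2)[OF X t st(1)] by simp
  moreover have "expectation (\<lambda>\<omega>. (X t \<omega> - X s \<omega>)\<^sup>2) = t - s"
  proof -
    have it: "integrable M (\<lambda>\<omega>. (X t \<omega>)\<^sup>2)" and is2: "integrable M (\<lambda>\<omega>. (X s \<omega>)\<^sup>2)"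
      and id: "integrable M (\<lambda>\<omega>. (X t \<omega> - X s \<omega>)\<^sup>2)"
      using nt ns nrv by (auto intro: normal_rv_integrable_power)
    \<comment> \<open>polarization, to get integrability of the product for free\<close>
    have eq: "X s \<omega> * X t \<omega> = ((X t \<omega>)\<^sup>2 + (X s \<omega>)\<^sup>2 - (X t \<omega> - X s \<omega>)\<^sup>2) / 2" for \<omega>
      by (simp add: power2_eq_square algebra_simps)
    have "min s t = (expectation (\<lambda>\<omega>. (X t \<omega>)\<^sup>2) + expectation (\<lambda>\<omega>. (X s \<omega>)\<^sup>2)
        - expectation (\<lambda>\<omega>. (X t \<omega> - X s \<omega>)\<^sup>2)) / 2"
      unfolding brownian_motion_normal(3)[OF X st(1) t, symmetric] eq using it is2 id by simp
    then show ?thesis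
      using st brownian_motion_normal(3)[OF X t t] brownian_motion_normal(3)[OF X st(1) st(1)]
      by (simp add: power2_eq_square)
  qed
  ultimately show "expectation (\<lambda>\<omega>. (X t \<omega> - X s \<omega>) ^ (2 * k)) = fact (2 * k) / (2 ^ k * fact k) * (t - s) ^ k"
    using normal_rv_moment_even[OF nrv, of "t - s" k] st by simp
qed

section \<open>Tail bounds and Borel-Cantelli for dyadic increments\<close>

lemma brownian_motion_increment_tail:
  assumes X: "brownian_motion X" and st: "0 \<le> s" "s < t" and c: "0 < c"
  shows "prob {\<omega> \<in> space M. c \<le> \<bar>X t \<omega> - X s \<omega>\<bar>} \<le> fact (2 * k) / (2 ^ k * fact k) * (t - s) ^ k / c ^ (2 * k)"
proof -
  note nrv = brownian_motion_increment(1)[OF X st]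
  note [measurable] = normal_rv_measurable[OF nrv]
  have "prob {\<omega> \<in> space M. c \<le> \<bar>X t \<omega> - X s \<omega>\<bar>} \<le> prob {\<omega> \<in> space M. c ^ (2 * k) \<le> (X t \<omega> - X s \<omega>) ^ (2 * k)}"
  proof (rule finite_measure_mono)
    show "{\<omega> \<in> space M. c \<le> \<bar>X t \<omega> - X s \<omega>\<bar>} \<subseteq> {\<omega> \<in> space M. c ^ (2 * k) \<le> (X t \<omega> - X s \<omega>) ^ (2 * k)}"
      using c by (auto dest!: power_mono[of c _ "2 * k"] simp: power_even_abs)
  qed measurable
  also have "\<dots> \<le> expectation (\<lambda>\<omega>. (X t \<omega> - X s \<omega>) ^ (2 * k)) / c ^ (2 * k)"
    using c by (intro integral_Markov_inequality_measure[where A="{}"] normal_rv_integrable_power[OF nrv]) auto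
  finally show ?thesis
    unfolding brownian_motion_increment(2)[OF X st] .
qed

lemma brownian_motion_dyadic_increments:
  assumes X: "brownian_motion X" and \<beta>: "\<beta> < 1 / 2"
  shows "AE \<omega> in M. \<exists>n0. \<forall>n\<ge>n0. \<forall>j < N * 2 ^ n.
    \<bar>X (real (j + 1) / 2 ^ n) \<omega> - X (real j / 2 ^ n) \<omega>\<bar> \<le> (2 powr - \<beta>) ^ n"
proof -
  define q :: real where "q = 2 powr - \<beta>"
  have q: "0 < q" by (simp add: q_def)
  \<comment> \<open>chosen so large that \<open>\<rho> < 1\<close> below\<close>
  obtain k :: nat where k: "1 / (1 - 2 * \<beta>) < real k"
    using reals_Archimedean2 by blast
  define c :: real where "c = fact (2 * k) / (2 ^ k * fact k)"
  \<comment> \<open>The factor 2 counts the intervals per level, \<open>(1 / 2) ^ k\<close> comes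
    from the moment and \<open>q ^ (2 * k)\<close> from the threshold. The exponent found next is
    negative because \<open>k * (1 - 2 * \<beta>) > 1\<close>.\<close>
  define \<rho> :: real where "\<rho> = 2 * (1 / 2) ^ k / q ^ (2 * k)"
  have "\<rho> = 2 powr (1 - real k + 2 * real k * \<beta>)"
    by (simp add: \<rho>_def q_def powr_power powr_add powr_diff powr_minus powr_realpow field_simps)
  moreover have "1 - real k + 2 * real k * \<beta> < 0"
    using k \<beta> by (simp add: field_simps)
  ultimately have \<rho>: "0 < \<rho>" "\<rho> < 1"
    by (auto simp: powr_less_one)
  let ?D = "\<lambda>n j \<omega>. \<bar>X (real (j + 1) / 2 ^ n) \<omega> - X (real j / 2 ^ n) \<omega>\<bar>"
  define A where "A n = (\<Union>j<N * 2 ^ n. {\<omega> \<in> space M. q ^ n \<le> ?D n j \<omega>})" for n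
  have [measurable]: "X t \<in> borel_measurable M" if "0 \<le> t" for t
    using X that by (auto simp: brownian_motion_def)
  have S: "{\<omega> \<in> space M. q ^ n \<le> ?D n j \<omega>} \<in> events" for n j
    by measurable
  have A: "A n \<in> events" for n
    unfolding A_def using S by auto
  have bound: "prob (A n) \<le> real N * c * \<rho> ^ n" for n
  proof -
    have "prob (A n) \<le> (\<Sum>j<N * 2 ^ n. prob {\<omega> \<in> space M. q ^ n \<le> ?D n j \<omega>})"
      unfolding A_def using S by (intro finite_measure_subadditive_finite) auto
    also have "\<dots> \<le> (\<Sum>j<N * 2 ^ n. c * ((1 / 2) ^ n) ^ k / (q ^ n) ^ (2 * k))"
    proof (rule sum_mono)
      fix j
      have "real (j + 1) / 2 ^ n - real j / 2 ^ n = (1 / 2) ^ n"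
        by (simp add: field_simps)
      then show "prob {\<omega> \<in> space M. q ^ n \<le> ?D n j \<omega>} \<le> c * ((1 / 2) ^ n) ^ k / (q ^ n) ^ (2 * k)"
        using brownian_motion_increment_tail[OF X, of "real j / 2 ^ n" "real (j + 1) / 2 ^ n" "q ^ n" k] q
        by (simp add: c_def divide_strict_right_mono)
    qed
    also have "\<dots> = real N * c * (2 ^ n * ((1 / 2) ^ n) ^ k / (q ^ n) ^ (2 * k))"
      by simp
    also have "2 ^ n * ((1 / 2) ^ n) ^ k / (q ^ n) ^ (2 * k) = \<rho> ^ n"
      by (simp add: \<rho>_def power_divide power_mult_distrib mult.commute flip: power_mult)
    finally show ?thesis .
  qed
  have "summable (\<lambda>n. prob (A n))"
  proof (rule summable_comparison_test)
    show "summable (\<lambda>n. real N * c * \<rho> ^ n)"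
      using \<rho> by (intro summable_mult summable_geometric) auto
  qed (use bound in auto)
  then have "AE \<omega> in M. \<forall>\<^sub>F n in sequentially. \<omega> \<in> space M - A n"
    using A by (intro borel_cantelli_AE1) (auto simp: emeasure_eq_measure)
  then show ?thesis
  proof (rule AE_mp, intro AE_I2 impI)
    fix \<omega> assume "\<omega> \<in> space M" "\<forall>\<^sub>F n in sequentially. \<omega> \<in> space M - A n"
    then obtain n0 where "\<And>n. n \<ge> n0 \<Longrightarrow> \<omega> \<in> space M - A n"
      by (auto simp: eventually_sequentially)
    then show "\<exists>n0. \<forall>n\<ge>n0. \<forall>j < N * 2 ^ n. ?D n j \<omega> \<le> (2 powr - \<beta>) ^ n"
      unfolding q_def[symmetric] A_def by (intro exI[of _ n0]) force
  qed
qed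

end

theorem mainTheorem2:
  fixes M :: "'a measure" and X :: "real \<Rightarrow> 'a \<Rightarrow> real" and \<beta> :: real
  assumes "prob_space M"
    and "prob_space.brownian_motion M X"
    and "0 < \<beta>" and "\<beta> < 1 / 2"
  shows "AE \<omega> in M. locally_holder \<beta> (\<lambda>t. X t \<omega>)"
proof -
  interpret prob_space M by fact
  \<comment> \<open>The horizons \<open>N\<close> are countably many, so a single null set serves
    them all; \<open>n0\<close> may depend on \<open>N\<close> and on the path.\<close>
  have "AE \<omega> in M. \<forall>N. \<exists>n0. \<forall>n\<ge>n0. \<forall>j < N * 2 ^ n.
      \<bar>X (real (j + 1) / 2 ^ n) \<omega> - X (real j / 2 ^ n) \<omega>\<bar> \<le> (2 powr - \<beta>) ^ n"
    unfolding AE_all_countable using brownian_motion_dyadic_increments[OF assms(2,4)] by blast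
  moreover have "AE \<omega> in M. continuous_on {0..} (\<lambda>t. X t \<omega>)"
    using assms(2) by (simp add: brownian_motion_def)
  ultimately show ?thesis
  proof eventually_elim
    case (elim \<omega>)
    show ?case
    proof (rule locally_holderI)
      fix N :: nat
      obtain n0 where "\<forall>n\<ge>n0. \<forall>j < N * 2 ^ n.
          \<bar>X (real (j + 1) / 2 ^ n) \<omega> - X (real j / 2 ^ n) \<omega>\<bar> \<le> (2 powr - \<beta>) ^ n"
        using elim(1) by blast
      then obtain C where "\<And>r s. r \<in> {0..<real N} \<Longrightarrow> s \<in> {0..<real N} \<Longrightarrow> \<bar>r - s\<bar> \<le> (1 / 2) ^ n0 \<Longrightarrow>
          \<bar>X r \<omega> - X s \<omega>\<bar> \<le> C * \<bar>r - s\<bar> powr \<beta>"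
        using dyadic_increments_imp_holder[OF elim(2) assms(3), of n0 N] by blast
      then show "\<exists>\<delta>>0. \<exists>C. \<forall>r\<in>{0..<real N}. \<forall>s\<in>{0..<real N}.
          \<bar>r - s\<bar> \<le> \<delta> \<longrightarrow> \<bar>X r \<omega> - X s \<omega>\<bar> \<le> C * \<bar>r - s\<bar> powr \<beta>"
        by (intro exI[of _ "(1 / 2) ^ n0"] conjI exI[of _ C]) auto
    qed
  qed
qed

end
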